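(* Let $n,\tau$ be positive integers with $\tau\ge\lceil 2n/3\rceil$, and let $\mathcal{D}_{n,\tau}$ be the set of connected graphs on $n$ vertices with dissociation number $\tau$. Then every graph in $\mathcal{D}_{n,\tau}$ with the minimum number of edges among all graphs in $\mathcal{D}_{n,\tau}$ is a tree.
   Context: A dissociation set of $G$ is a vertex set inducing a subgraph of maximum degree at most $1$; the dissociation number is the largest size of a dissociation set. *)

theory Defs
  imports Complex_Main "Graph_Theory.Graph_Theory"
begin

text \<open>
  A finite simple graph is a \<^locale>\<open>pair_graph\<close>: a finite, symmetric, loopfree digraph
  without parallel arcs. Each undirected edge is represented by two opposite arcs, hence the
  edges are counted through their unordered sets of endpoints.
\<close>

definition edges :: "'a pair_pre_digraph \<Rightarrow> 'a set set" where
  "edges G = (\<lambda>(u, v). {u, v}) ` parcs G"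

text \<open>
  The library's notions of forest and tree are the directed ones, for which any pair of
  opposite arcs is a cycle. In a simple graph the cycles are the closed walks without repeated
  vertices of length at least 3.
\<close>

definition graph_cycle :: "'a pair_pre_digraph \<Rightarrow> ('a \<times> 'a) awalk \<Rightarrow> bool" where
  "graph_cycle G p \<longleftrightarrow> pre_digraph.cycle (with_proj G) p \<and> 3 \<le> length p"

definition graph_tree :: "'a pair_pre_digraph \<Rightarrow> bool" where
  "graph_tree G \<longleftrightarrow> Digraph_Component.connected (with_proj G) \<and> (\<nexists>p. graph_cycle G p)"

text \<open>
  By symmetry, the out-degree of a vertex is its degree in the undirected graph.
\<close>

definition dissociation_set :: "'a pair_pre_digraph \<Rightarrow> 'a set \<Rightarrow> bool" where
  "dissociation_set G S \<longleftrightarrow>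
    S \<subseteq> pverts G \<and> (\<forall>v\<in>S. out_degree (with_proj G \<restriction> S) v \<le> 1)"

definition dissociation_number :: "'a pair_pre_digraph \<Rightarrow> nat" where
  "dissociation_number G = Max {card S |S. dissociation_set G S}"

definition dissociation_class :: "nat \<Rightarrow> nat \<Rightarrow> 'a pair_pre_digraph set" where
  "dissociation_class n \<tau> =
    {G. pair_graph G \<and> Digraph_Component.connected (with_proj G) \<and>
        card (pverts G) = n \<and> dissociation_number G = \<tau>}"

end

theory Submission
  imports Defs
begin

text \<open>
  A connected graph on \<open>n\<close> vertices has at least \<open>n - 1\<close> edges, and at least \<open>n\<close> if it contains a
  cycle, since an edge of the cycle can be deleted. So it suffices to exhibit a member of the class
  with at most \<open>n - 1\<close> edges. Put \<open>k = n - \<tau>\<close>, so that \<open>3 * k \<le> n\<close>. If \<open>k = 0\<close> then the graph itself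
  has maximum degree at most 1 and hence no cycle. Otherwise take a star on \<open>k\<close> centres and
  distribute the other \<open>n - k \<ge> 2 * k\<close> vertices as leaves, at least two at every centre. The leaves
  are independent, and a dissociation set misses a vertex in each of \<open>k\<close> disjoint paths
  leaf-centre-leaf.
\<close>

section \<open>Edges needed to reach a vertex set\<close>

text \<open>Each vertex of \<open>V\<close> other than \<open>r\<close> has an edge to a vertex
  strictly nearer to \<open>r\<close>, and two vertices cannot share such an edge, since each would
  be nearer than the other. \<open>R\<close> is a bare relation so that an edge can be deleted from
  it without building a new graph.\<close>

lemma card_reachable_le_edges:
  assumes fin: "finite R"
    and reach: "\<And>v. v \<in> V \<Longrightarrow> (r, v) \<in> R\<^sup>*"
  shows "card V \<le> card ((\<lambda>(u, v). {u, v}) ` R) + 1"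
proof -
  \<comment> \<open>The breadth-first distance from \<open>r\<close>.\<close>
  define d where "d v = (LEAST m. (r, v) \<in> R ^^ m)" for v
  have d_le: "d v \<le> m" if "(r, v) \<in> R ^^ m" for v m
    unfolding d_def using that by (rule Least_le)
  have "\<exists>u. (u, v) \<in> R \<and> d u < d v" if v: "v \<in> V - {r}" for v
  proof -
    have "\<exists>m. (r, v) \<in> R ^^ m"
      using reach v by (auto simp: rtrancl_is_UN_relpow)
    then have dv: "(r, v) \<in> R ^^ d v"
      unfolding d_def by (rule LeastI_ex)
    obtain m where m: "d v = Suc m"
      using dv v by (cases "d v") auto
    obtain u where "(r, u) \<in> R ^^ m" "(u, v) \<in> R"
      using dv unfolding m by auto
    then show ?thesis
      using d_le[of u m] m by auto
  qed
  then obtain f where f: "\<And>v. v \<in> V - {r} \<Longrightarrow> (f v, v) \<in> R \<and> d (f v) < d v"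
    by metis
  have "inj_on (\<lambda>v. {f v, v}) (V - {r})"
  proof (rule inj_onI)
    fix v w assume vw: "v \<in> V - {r}" "w \<in> V - {r}" "{f v, v} = {f w, w}"
    have "\<not> (f v = w \<and> f w = v)"
      using f[OF vw(1)] f[OF vw(2)] by auto
    then show "v = w"
      using vw(3) by (auto simp: doubleton_eq_iff)
  qed
  moreover have "(\<lambda>v. {f v, v}) ` (V - {r}) \<subseteq> (\<lambda>(u, v). {u, v}) ` R"
    using f by force
  ultimately have "card (V - {r}) \<le> card ((\<lambda>(u, v). {u, v}) ` R)"
    using fin by (intro card_inj_on_le) auto
  moreover have "card V \<le> card (V - {r}) + 1"
    by (cases "finite V") (auto simp: card_Diff_singleton_if)
  ultimately show ?thesis by linarith
qed

text \<open>The deleted arcs can be bypassed: the detour from \<open>b\<close> to \<open>a\<close>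
  can be walked in both directions by symmetry.\<close>

lemma rtrancl_delete_edge:
  assumes "sym R" and ba: "(b, a) \<in> (R - {(a, b), (b, a)})\<^sup>*"
  shows "(R - {(a, b), (b, a)})\<^sup>* = R\<^sup>*"
proof -
  let ?R = "R - {(a, b), (b, a)}"
  have "sym ?R"
    using assms(1) by (auto simp: sym_def)
  then have "(a, b) \<in> ?R\<^sup>*"
    using ba by (meson sym_rtrancl symD)
  then have "R \<subseteq> ?R\<^sup>*"
    using ba by auto
  then show ?thesis
    by (rule rtrancl_subset[symmetric, rotated]) blast
qed

section \<open>Cycles as closed walks\<close>

lemma pcas_rtrancl:
  assumes "pcas u p v" "set p \<subseteq> R"
  shows "(u, v) \<in> R\<^sup>*"
  using assms
proof (induction p arbitrary: u)
  case (Cons e p)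
  then have "(u, snd e) \<in> R" "(snd e, v) \<in> R\<^sup>*"
    by auto
  then show ?case
    by (rule converse_rtrancl_into_rtrancl)
qed simp

lemma pcas_last:
  assumes "pcas u p v" "p \<noteq> []"
  shows "v \<in> snd ` set p"
  using assms
proof (induction p arbitrary: u)
  case (Cons e p)
  then show ?case by (cases p) auto
qed simp

lemma pcas_tail:
  assumes "pcas u p v" "e \<in> set p"
  shows "fst e = u \<or> fst e \<in> snd ` set p"
  using assms by (induction p arbitrary: u) auto

text \<open>This turns the distinctness condition in the library's \<open>cycle\<close> into
  distinctness of the heads of the arcs.\<close>

lemma tl_pawalk_verts:
  assumes "pcas u p v"
  shows "tl (pawalk_verts u p) = map snd p"
  using assms
proof (induction p arbitrary: u)
  case (Cons e p)
  then show ?case by (cases p) auto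
qed simp

text \<open>Take the first two arcs of the cycle. What follows the first arc leads from
  \<open>b\<close> back to \<open>a\<close>, and distinctness of the heads keeps it off that edge in
  both directions.\<close>

lemma graph_cycleE:
  assumes "graph_cycle G p"
  obtains a b c where "(a, b) \<in> parcs G" "(b, c) \<in> parcs G" "a \<noteq> c"
    "(b, a) \<in> (parcs G - {(a, b), (b, a)})\<^sup>*"
proof -
  obtain u where u: "pcas u p u" "set p \<subseteq> parcs G" "distinct (map snd p)"
    and len: "3 \<le> length p"
    using assms unfolding graph_cycle_def pre_digraph.cycle_def pre_digraph.awalk_def
    by (auto simp: cas_with_proj_eq awalk_verts_with_proj_eq tl_pawalk_verts)
  obtain e1 e2 q where p: "p = e1 # e2 # q" and q: "q \<noteq> []"
    using len by (auto simp: numeral_3_eq_3 Suc_le_length_iff)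
  obtain a b c where e: "e1 = (a, b)" "e2 = (b, c)"
    using u(1) unfolding p by (cases e1; cases e2) auto
  have cq: "pcas c q a"
    using u(1) unfolding p e by auto
  have "a \<in> snd ` set q"
    using pcas_last[OF cq q] .
  then have ac: "a \<noteq> c"
    using u(3) unfolding p e by auto
  \<comment> \<open>The tail \<open>b\<close> of such an arc would be \<open>c\<close> or a head in
    \<open>q\<close>, but \<open>b\<close> is already the head of \<open>e1\<close>.\<close>
  have "(b, a) \<notin> set q"
    using pcas_tail[OF cq, of "(b, a)"] u(3) unfolding p e by auto
  moreover have "(a, b) \<notin> set (e2 # q)" "(b, a) \<noteq> e2"
    using u(3) ac unfolding p e by (auto simp: image_iff)
  ultimately have "set (e2 # q) \<subseteq> parcs G - {(a, b), (b, a)}"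
    using u(2) unfolding p by auto
  moreover have "pcas b (e2 # q) a"
    using cq e by simp
  ultimately have "(b, a) \<in> (parcs G - {(a, b), (b, a)})\<^sup>*"
    by (intro pcas_rtrancl)
  then show thesis
    using that[of a b c] u(2) ac unfolding p e by auto
qed

section \<open>Connectedness and dissociation sets\<close>

context pair_graph
begin

lemma sym_parcs: "sym (parcs G)"
  by (auto simp: sym_def intro: arcs_symmetric)

text \<open>The library defines connectedness through the symmetric closure, which leaves a
  symmetric graph unchanged.\<close>

lemma connected_iff_rtrancl:
  "Digraph_Component.connected (with_proj G) \<longleftrightarrow>
    pverts G \<noteq> {} \<and> (\<forall>u\<in>pverts G. \<forall>v\<in>pverts G. (u, v) \<in> (parcs G)\<^sup>*)"
proof -
  have "parcs (mk_symmetric (with_proj G)) = parcs G"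
    using adj_mk_symmetric_eq[OF pair_sym_arcs] by simp
  then have "mk_symmetric (with_proj G) = G"
    by (simp add: mk_symmetric_def)
  moreover have "u \<rightarrow>\<^sup>*\<^bsub>with_proj G\<^esub> v \<longleftrightarrow> (u, v) \<in> (parcs G)\<^sup>*" if "u \<in> pverts G" for u v
    using reachable_conv'[OF that] by simp
  ultimately show ?thesis
    unfolding Digraph_Component.connected_def strongly_connected_def by auto
qed

lemma dissociation_set_iff:
  "dissociation_set G S \<longleftrightarrow>
    S \<subseteq> pverts G \<and> (\<forall>v\<in>S. card {w \<in> S. (v, w) \<in> parcs G} \<le> 1)"
proof -
  have "out_degree (with_proj G \<restriction> S) v = card {w \<in> S. (v, w) \<in> parcs G}" if "v \<in> S" for v
  proof -
    have "out_arcs (with_proj G \<restriction> S) v = Pair v ` {w \<in> S. (v, w) \<in> parcs G}"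
      using that by (auto simp: out_arcs_def induce_subgraph_def)
    then show ?thesis
      by (simp add: out_degree_def card_image inj_on_def)
  qed
  then show ?thesis
    by (simp add: dissociation_set_def)
qed

lemma dissociation_setD:
  assumes "dissociation_set G S" "v \<in> S" "x \<in> S" "y \<in> S" "(v, x) \<in> parcs G" "(v, y) \<in> parcs G"
  shows "x = y"
proof -
  have "finite {w \<in> S. (v, w) \<in> parcs G}"
    using assms(1) pair_finite_verts unfolding dissociation_set_def
    by (auto intro: finite_subset[of _ "pverts G"])
  moreover have "card {w \<in> S. (v, w) \<in> parcs G} \<le> 1"
    using assms(1,2) unfolding dissociation_set_iff by auto
  ultimately show ?thesis
    using assms(3-6) by (simp add: card_le_Suc0_iff_eq)
qed

lemma finite_dissociation_cards: "finite {card S |S. dissociation_set G S}"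
proof -
  have "finite {S. dissociation_set G S}"
    using pair_finite_verts
    by (auto simp: dissociation_set_def intro: finite_subset[of _ "Pow (pverts G)"])
  then show ?thesis by simp
qed

text \<open>The empty dissociation set ensures that the \<open>Max\<close> is attained.\<close>

lemma dissociation_numberE:
  obtains S where "dissociation_set G S" "card S = dissociation_number G"
proof -
  have "dissociation_set G {}"
    by (simp add: dissociation_set_iff)
  then have "dissociation_number G \<in> {card S |S. dissociation_set G S}"
    unfolding dissociation_number_def using finite_dissociation_cards by (intro Max_in) auto
  then show thesis
    using that by auto
qed

lemma connected_cycle_card_le_edges:
  assumes conn: "Digraph_Component.connected (with_proj G)" and "graph_cycle G p"
  shows "card (pverts G) \<le> card (edges G)"
proof -
  obtain a b where ab: "(a, b) \<in> parcs G" "(b, a) \<in> (parcs G - {(a, b), (b, a)})\<^sup>*"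
    using graph_cycleE[OF assms(2)] by metis
  let ?R = "parcs G - {(a, b), (b, a)}"
  have "a \<in> pverts G"
    using ab(1) by (rule in_arcsD1)
  then have "card (pverts G) \<le> card ((\<lambda>(u, v). {u, v}) ` ?R) + 1"
    using conn pair_finite_arcs unfolding connected_iff_rtrancl
    by (intro card_reachable_le_edges[of _ _ a])
      (auto simp: rtrancl_delete_edge[OF sym_parcs ab(2)])
  \<comment> \<open>Both arcs over \<open>{a, b}\<close> are gone from \<open>?R\<close>, so exactly
    this edge makes up for the \<open>+ 1\<close>.\<close>
  moreover have "{a, b} \<in> edges G" "{a, b} \<notin> (\<lambda>(u, v). {u, v}) ` ?R"
    "(\<lambda>(u, v). {u, v}) ` ?R \<subseteq> edges G"
    using ab(1) by (auto simp: edges_def doubleton_eq_iff)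
  then have "(\<lambda>(u, v). {u, v}) ` ?R \<subset> edges G"
    by blast
  then have "card ((\<lambda>(u, v). {u, v}) ` ?R) < card (edges G)"
    by (intro psubset_card_mono) (auto simp: edges_def pair_finite_arcs)
  ultimately show ?thesis by linarith
qed

text \<open>A cycle has a vertex \<open>b\<close> with two distinct neighbours \<open>a\<close> and
  \<open>c\<close>.\<close>

lemma no_cycle_if_dissociation_set_all:
  assumes "dissociation_set G (pverts G)"
  shows "\<not> graph_cycle G p"
proof
  assume "graph_cycle G p"
  then obtain a b c where "(a, b) \<in> parcs G" "(b, c) \<in> parcs G" "a \<noteq> c"
    by (rule graph_cycleE)
  then show False
    using dissociation_setD[OF assms, of b a c]
    by (auto intro: arcs_symmetric dest: wellformed')
qed

end

section \<open>A sparse member of the class\<close>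

text \<open>The type \<open>'a\<close> may be finite, so the graph is built on a given set
  \<open>V\<close>, numbered by \<open>h\<close>. Indices below \<open>k\<close> are the centres,
  the others the leaves.\<close>

lemma dissociation_class_sparse_member:
  fixes V :: "'a set"
  assumes V: "finite V" "card V = n" and k: "0 < k" "3 * k \<le> n"
  obtains T :: "'a pair_pre_digraph" where "T \<in> dissociation_class n (n - k)"
    and "card (edges T) \<le> n - 1"
proof -
  obtain h where h: "bij_betw h {0..<n} V"
    using ex_bij_betw_nat_finite[OF V(1)] V(2) by auto
  have inj: "h i = h j \<longleftrightarrow> i = j" if "i < n" "j < n" for i j
    using h that by (auto simp: bij_betw_def inj_on_def)
  have hV: "V = h ` {0..<n}"
    using h by (simp add: bij_betw_def)
  \<comment> \<open>The parent of \<open>i\<close> in the tree rooted at 0: centres hang on 0, a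
    leaf on the centre in its residue class modulo \<open>k\<close>. The value
    \<open>par 0 = 0\<close> yields no arc, as arcs start from \<open>i = 1\<close>.\<close>
  define par where "par i = (if i < k then 0 else i mod k)" for i
  \<comment> \<open>This excludes loops and lets induction reach every vertex from
    \<open>h 0\<close>.\<close>
  have par_less: "par i < i" if "0 < i" for i
    using that k(1) by (auto simp: par_def intro: less_le_trans[OF mod_less_divisor])
  have par_k: "par i < k" for i
    using k(1) by (simp add: par_def)
  define T where "T = \<lparr>pverts = V,
    parcs = (\<Union>i\<in>{1..<n}. {(h i, h (par i)), (h (par i), h i)})\<rparr>"
  have par_n: "par i < n" if "i \<in> {1..<n}" for i
    using par_less[of i] that by auto
  interpret T: pair_graph T
  proof (unfold_locales, goal_cases)
    case (1 e) then show ?case using par_n by (auto simp: T_def hV)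
  next
    case (2 e) then show ?case using par_n by (auto simp: T_def hV)
  next
    case 3 then show ?case by (simp add: T_def V)
  next
    case 4 then show ?case by (simp add: T_def)
  next
    case (5 e)
    then obtain i where "i \<in> {1..<n}" "e = (h i, h (par i)) \<or> e = (h (par i), h i)"
      by (auto simp: T_def)
    then show ?case using par_less[of i] inj[of i "par i"] by auto
  next
    case 6 then show ?case by (auto simp: symmetric_def sym_def T_def)
  qed
  have arc: "(h (par i), h i) \<in> parcs T" if "i \<in> {1..<n}" for i
    using that by (auto simp: T_def)
  have root: "(h 0, h i) \<in> (parcs T)\<^sup>*" if "i < n" for i
    using that
  proof (induction i rule: less_induct)
    case (less i)
    show ?case
    proof (cases "i = 0")
      case False
      then have "(h 0, h (par i)) \<in> (parcs T)\<^sup>*"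
        using less par_less[of i] by auto
      then show ?thesis
        using arc[of i] False less.prems by (auto intro: rtrancl_into_rtrancl)
    qed simp
  qed
  then have "(h i, h j) \<in> (parcs T)\<^sup>*" if "i < n" "j < n" for i j
    using that sym_rtrancl[OF T.sym_parcs] by (meson rtrancl_trans symD)
  moreover have "pverts T = h ` {0..<n}" "0 < n"
    using k by (auto simp: T_def hV)
  ultimately have conn: "Digraph_Component.connected (with_proj T)"
    unfolding T.connected_iff_rtrancl by auto
  have upper: "card S \<le> n - k" if S: "dissociation_set T S" for S
  proof -
    \<comment> \<open>Otherwise the centre \<open>c\<close> and its leaves \<open>k + c\<close> and
      \<open>2 * k + c\<close>, which exist because \<open>3 * k \<le> n\<close>, would all lie in
      \<open>S\<close>.\<close>
    have "\<exists>i<n. i mod k = c \<and> h i \<notin> S" if c: "c < k" for c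
    proof (rule ccontr)
      assume "\<not> ?thesis"
      moreover have "c < n" "k + c < n" "2 * k + c < n"
        using c k by auto
      ultimately have "h c \<in> S" "h (k + c) \<in> S" "h (2 * k + c) \<in> S"
        using c by auto
      moreover have "par (k + c) = c" "par (2 * k + c) = c"
        using c by (auto simp: par_def)
      then have "(h c, h (k + c)) \<in> parcs T" "(h c, h (2 * k + c)) \<in> parcs T"
        using arc[of "k + c"] arc[of "2 * k + c"] c k by auto
      ultimately have "h (k + c) = h (2 * k + c)"
        using T.dissociation_setD[OF S] by blast
      then show False
        using inj c k by auto
    qed
    then obtain m where m: "\<And>c. c < k \<Longrightarrow> m c < n \<and> m c mod k = c \<and> h (m c) \<notin> S"
      by metis
    \<comment> \<open>The missed index \<open>m c\<close> determines its residue class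
      \<open>c\<close>, so \<open>S\<close> misses at least \<open>k\<close> vertices.\<close>
    have "inj_on (\<lambda>c. h (m c)) {..<k}"
    proof (rule inj_onI)
      fix x y assume "x \<in> {..<k}" "y \<in> {..<k}" "h (m x) = h (m y)"
      then show "x = y"
        by (metis m inj lessThan_iff)
    qed
    then have "k \<le> card (V - S)"
      using card_inj_on_le[of _ "{..<k}" "V - S"] m V(1) by (force simp: hV)
    moreover have "S \<subseteq> V"
      using S by (simp add: dissociation_set_def T_def)
    then have "card (V - S) = n - card S"
      using V by (metis card_Diff_subset finite_subset)
    ultimately show ?thesis
      using k by linarith
  qed
  have leaves: "dissociation_set T (h ` {k..<n})"
  proof -
    \<comment> \<open>Every arc has an endpoint \<open>h (par l)\<close>, and parents are
      centres.\<close>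
    have "(h i, h j) \<notin> parcs T" if ij: "i \<in> {k..<n}" "j \<in> {k..<n}" for i j
    proof
      assume "(h i, h j) \<in> parcs T"
      then obtain l where "l \<in> {1..<n}" "h i = h (par l) \<or> h j = h (par l)"
        by (auto simp: T_def)
      then have "i = par l \<or> j = par l"
        using inj[of i "par l"] inj[of j "par l"] par_n[of l] ij by auto
      then show False
        using par_k[of l] ij by auto
    qed
    then have "{w \<in> h ` {k..<n}. (v, w) \<in> parcs T} = {}" if "v \<in> h ` {k..<n}" for v
      using that by auto
    then have "\<forall>v\<in>h ` {k..<n}. card {w \<in> h ` {k..<n}. (v, w) \<in> parcs T} \<le> 1"
      by (metis (no_types, lifting) card.empty zero_le)
    moreover have "h ` {k..<n} \<subseteq> pverts T"
      by (auto simp: T_def hV)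
    ultimately show ?thesis
      unfolding T.dissociation_set_iff by blast
  qed
  have "card (h ` {k..<n}) = n - k"
    using inj by (simp add: card_image inj_on_def)
  then have "n - k \<in> {card S |S. dissociation_set T S}"
    using leaves by (metis (mono_tags, lifting) mem_Collect_eq)
  then have "dissociation_number T = n - k"
    unfolding dissociation_number_def
    using upper by (intro Max_eqI T.finite_dissociation_cards) auto
  moreover have "card (pverts T) = n"
    by (simp add: T_def V)
  ultimately have "T \<in> dissociation_class n (n - k)"
    using conn T.pair_graph by (simp add: dissociation_class_def)
  \<comment> \<open>Each index other than the root contributes only the edge to its parent.\<close>
  moreover have "edges T \<subseteq> (\<lambda>i. {h i, h (par i)}) ` {1..<n}"
    by (auto simp: edges_def T_def)
  then have "card (edges T) \<le> n - 1"
    using surj_card_le[of "{1..<n}" "edges T" "\<lambda>i. {h i, h (par i)}"] by simp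
  ultimately show thesis
    by (rule that)
qed

section \<open>Acyclicity of the minimum members\<close>

theorem theorem4p3:
  fixes n \<tau> :: nat and G :: "'a pair_pre_digraph"
  assumes "n > 0" and "\<tau> > 0"
    and "int \<tau> \<ge> \<lceil>2 * real n / 3\<rceil>"
    and "is_arg_min (\<lambda>H. card (edges H)) (\<lambda>H. H \<in> dissociation_class n \<tau>) G"
  shows "graph_tree G"
proof -
  have G: "pair_graph G" "Digraph_Component.connected (with_proj G)"
    "card (pverts G) = n" "dissociation_number G = \<tau>"
    and min: "\<And>H :: 'a pair_pre_digraph. H \<in> dissociation_class n \<tau> \<Longrightarrow>
      card (edges G) \<le> card (edges H)"
    using assms(4) by (auto simp: is_arg_min_linorder dissociation_class_def)
  interpret pair_graph G by (rule G(1))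
  obtain S where S: "dissociation_set G S" "card S = \<tau>"
    using dissociation_numberE unfolding G(4) by blast
  have SV: "S \<subseteq> pverts G"
    using S(1) by (simp add: dissociation_set_def)
  have "\<tau> \<le> n"
    using card_mono[OF pair_finite_verts SV] S(2) G(3) by simp
  have "2 * real n / 3 \<le> real \<tau>"
    using assms(3) by (simp add: ceiling_le_iff)
  then have "2 * n \<le> 3 * \<tau>"
    by linarith
  have "\<not> graph_cycle G p" for p
  proof (cases "\<tau> = n")
    case True
    then have "S = pverts G"
      using card_subset_eq[OF pair_finite_verts SV] S(2) G(3) by simp
    then show ?thesis
      using S(1) no_cycle_if_dissociation_set_all by simp
  next
    case False
    have "0 < n - \<tau>" "3 * (n - \<tau>) \<le> n" "n - (n - \<tau>) = \<tau>"
      using False \<open>\<tau> \<le> n\<close> \<open>2 * n \<le> 3 * \<tau>\<close> by linarith+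
    then obtain T :: "'a pair_pre_digraph" where "T \<in> dissociation_class n \<tau>"
      "card (edges T) \<le> n - 1"
      \<comment> \<open>The competitor reuses the vertex set of \<open>G\<close>, with
        \<open>k = n - \<tau>\<close>.\<close>
      using dissociation_class_sparse_member[OF pair_finite_verts G(3)] by metis
    then have "card (edges G) < n"
      using min[of T] assms(1) by linarith
    then show ?thesis
      using connected_cycle_card_le_edges[OF G(2)] unfolding G(3) by (meson leD)
  qed
  then show ?thesis
    using G(2) by (simp add: graph_tree_def)
qed

end
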